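(* Let $B\in M(n;\mathbb{R})$ and $d\in\mathbb{R}^n$, and let $c:\mathbb{R}\to\mathbb{R}^n$ be a solution of the inhomogeneous linear differential equation $\ddot c(t)=Bc(t)+d$ for which $\dot c(0),\ddot c(0),\ldots,c^{(n)}(0)$ are linearly independent. Then $c$ is affinely invariant under the semidiscrete flow.
   Context: $M(n;\mathbb{R})$ is the space of real $n\times n$ matrices. The semidiscrete flow $s\mapsto (x_j(s))_{j\in\mathbb{Z}}$ of a polygon $(x_j)_{j\in\mathbb{Z}}$ in $\mathbb{R}^n$ is defined by $\frac{dx_j(s)}{ds}=x_{j-1}(s)-2x_j(s)+x_{j+1}(s)$, $x_j(0)=x_j$. A smooth curve $c:\mathbb{R}\to\mathbb{R}^n$ is called affinely invariant under the semidiscrete flow (or a soliton of it) if there are $\epsilon>0$ and, for every $s\in[0,\epsilon)$, an affine map $x\mapsto\widetilde A(s)x+\widetilde b(s)$ of $\mathbb{R}^n$ (with $\widetilde A(s)\in M(n;\mathbb{R})$, $\widetilde b(s)\in\mathbb{R}^n$) such that the family $\widetilde c_s(t)=\widetilde A(s)c(t)+\widetilde b(s)$ is continuous in $s\in[0,\epsilon)$ for each $t$, satisfies $\widetilde c_0(t)=c(t)$ for all $t\in\mathbb{R}$, and solves $$\frac{\partial\widetilde c_s(t)}{\partial s}=\widetilde c_s(t-1)-2\widetilde c_s(t)+\widetilde c_s(t+1)$$ for all $s\in(0,\epsilon)$, $t\in\mathbb{R}$. *)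

theory Defs
  imports "HOL-Analysis.Analysis"
begin

definition curve_deriv :: "(real \<Rightarrow> 'a::real_normed_vector) \<Rightarrow> real \<Rightarrow> 'a" where
  "curve_deriv c t = vector_derivative c (at t)"

text \<open>The term \<open>(curve_deriv ^^ k) c\<close> is the \<open>k\<close>-th derivative of \<open>c\<close> provided the derivatives
  of lower order are differentiable (\<^const>\<open>vector_derivative\<close> is a total choice function).\<close>

definition smooth_curve :: "(real \<Rightarrow> 'a::real_normed_vector) \<Rightarrow> bool" where
  "smooth_curve c \<longleftrightarrow> (\<forall>k t. (curve_deriv ^^ k) c differentiable (at t))"

text \<open>No regularity of \<open>A\<close> and \<open>b\<close> in \<open>s\<close> is required beyond the stated conditions on the
  family of curves.\<close>

definition affinely_invariant :: "(real \<Rightarrow> real ^ 'n) \<Rightarrow> bool" where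
  "affinely_invariant c \<longleftrightarrow> smooth_curve c \<and>
     (\<exists>\<epsilon>>0. \<exists>(A :: real \<Rightarrow> real ^ 'n ^ 'n) (b :: real \<Rightarrow> real ^ 'n).
        let C = (\<lambda>s t. A s *v c t + b s) in
          (\<forall>t. continuous_on {0..<\<epsilon>} (\<lambda>s. C s t)) \<and>
          (\<forall>t. C 0 t = c t) \<and>
          (\<forall>s\<in>{0<..<\<epsilon>}. \<forall>t.
             ((\<lambda>s. C s t) has_vector_derivative
                (C s (t - 1) - 2 *\<^sub>R C s t + C s (t + 1))) (at s)))"

end

theory Submission
  imports Defs
begin

text \<open>Write \<open>\<Delta>c (t) = c (t - 1) - 2 c (t) + c (t + 1)\<close> for the second difference. The curve \<open>c\<close> is
  affinely invariant because \<open>\<Delta>c (t) = M c (t) + m\<close> for a fixed affine map: the semidiscrete flow then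
  stays inside the affine images of \<open>c\<close>, where it is a linear ordinary differential equation with
  constant coefficients.

  The affine relation is an addition theorem like \<open>cos (t + 1) + cos (t - 1) = 2 cos 1 cos t\<close>. For
  \<open>c'' = B c\<close> the value \<open>c (t + h)\<close> is \<open>cosh (h \<surd>B) c (t)\<close> plus a term linear in \<open>c' (t)\<close> that is odd
  in \<open>h\<close>, so that the velocity cancels from \<open>c (t + 1) + c (t - 1)\<close> and \<open>M = 2 cosh \<surd>B - 2\<close>; the
  constant \<open>d\<close> only adds a translation. Here \<open>cosh \<surd>B\<close> stands for its power series in \<open>B\<close>. Instead of summing
  this power series, \<open>second_difference_affine\<close> lets \<open>(c, c', 1)\<close> evolve under a first-order system
  and uses that reversing the velocity conjugates its flow to the inverse flow.

  Given \<open>M\<close> and \<open>m\<close>, the sought maps solve \<open>A' = A M\<close>, \<open>b' = A m\<close>, \<open>A (0) = 1\<close>, \<open>b (0) = 0\<close>.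
  In homogeneous coordinates both are read off from the exponential of
  \<open>(x, r) \<mapsto> (M x + r m, 0)\<close>; see \<open>affinely_invariant_if_second_difference_affine\<close>.

  Both steps, and the smoothness of \<open>c\<close>, rest on the exponential of a linear operator and on the
  fact that it gives every solution of the corresponding differential equation
  (\<open>linear_ode_eq_op_exp\<close>).\<close>

section \<open>The exponential of a linear operator\<close>

text \<open>The exponential is taken pointwise, as a vector-valued series, so that it applies to operators
  on products of Euclidean spaces without a normed algebra of operators.\<close>

definition op_exp :: "('a::euclidean_space \<Rightarrow> 'a) \<Rightarrow> real \<Rightarrow> 'a \<Rightarrow> 'a" where
  "op_exp T s x = (\<Sum>k. (s ^ k / fact k) *\<^sub>R (T ^^ k) x)"

lemma linear_funpow:
  fixes T :: "'a::real_vector \<Rightarrow> 'a"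
  assumes "linear T"
  shows "linear (T ^^ k)"
proof (induction k)
  case (Suc k)
  then show ?case
    using linear_compose[OF Suc assms] by (simp add: o_def)
qed (simp add: linear_iff)

lemma norm_funpow_le:
  fixes T :: "'a::real_normed_vector \<Rightarrow> 'a"
  assumes "\<And>x. norm (T x) \<le> K * norm x" and "K \<ge> 0"
  shows "norm ((T ^^ k) x) \<le> K ^ k * norm x"
proof (induction k)
  case (Suc k)
  have "norm ((T ^^ Suc k) x) \<le> K * norm ((T ^^ k) x)"
    using assms(1) by simp
  also have "\<dots> \<le> K * (K ^ k * norm x)"
    using Suc assms(2) by (intro mult_left_mono) auto
  finally show ?case by (simp add: mult_ac)
qed simp

lemma summable_op_exp:
  fixes T :: "'a::euclidean_space \<Rightarrow> 'a"
  assumes "linear T"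
  shows "summable (\<lambda>k. (s ^ k / fact k) *\<^sub>R (T ^^ k) x)"
proof -
  obtain K where K: "K > 0" "\<And>x. norm (T x) \<le> K * norm x"
    using linear_bounded_pos[OF assms] by blast
  have "summable (\<lambda>k. norm x * (inverse (fact k) * (\<bar>s\<bar> * K) ^ k))"
    by (intro summable_mult summable_exp)
  then show ?thesis
  proof (rule summable_comparison_test'[where N = 0])
    fix k :: nat
    have "norm ((s ^ k / fact k) *\<^sub>R (T ^^ k) x) = \<bar>s\<bar> ^ k / fact k * norm ((T ^^ k) x)"
      by (simp add: power_abs)
    also have "\<dots> \<le> \<bar>s\<bar> ^ k / fact k * (K ^ k * norm x)"
      using norm_funpow_le[of T K] K by (intro mult_left_mono) auto
    also have "\<dots> = norm x * (inverse (fact k) * (\<bar>s\<bar> * K) ^ k)"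
      by (simp add: power_mult_distrib divide_inverse)
    finally show "norm ((s ^ k / fact k) *\<^sub>R (T ^^ k) x)
        \<le> norm x * (inverse (fact k) * (\<bar>s\<bar> * K) ^ k)" .
  qed
qed

lemma linear_op_exp:
  assumes "linear T"
  shows "linear (op_exp T s)"
proof (rule linearI)
  note lin = linear_add[OF linear_funpow[OF assms]] linear_scale[OF linear_funpow[OF assms]]
  note sm = summable_op_exp[OF assms]
  show "op_exp T s (x + y) = op_exp T s x + op_exp T s y" for x y
    unfolding op_exp_def by (simp add: lin scaleR_add_right suminf_add[OF sm sm])
  show "op_exp T s (r *\<^sub>R x) = r *\<^sub>R op_exp T s x" for r x
    unfolding op_exp_def
    by (simp add: lin suminf_scaleR_right[OF sm] mult.commute)
qed

lemma op_exp_0: "op_exp T 0 x = x"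
proof -
  have "op_exp T 0 x = (\<Sum>k\<in>{0::nat}. (0 ^ k / fact k) *\<^sub>R (T ^^ k) x)"
    unfolding op_exp_def by (rule suminf_finite) auto
  then show ?thesis by simp
qed

text \<open>An intertwining relation passes through each term of the series. It serves in two ways: with
  \<open>R = T\<close> it shows that the exponential commutes with its generator, and with \<open>R\<close> the reversal of
  velocities and \<open>U = - T\<close> it expresses time reversal.\<close>

lemma op_exp_intertwine:
  fixes T :: "'a::euclidean_space \<Rightarrow> 'a" and U :: "'b::euclidean_space \<Rightarrow> 'b"
  assumes "linear T" and "linear R" and "\<And>x. R (T x) = U (R x)"
  shows "R (op_exp T s x) = op_exp U s (R x)"
proof -
  have R: "bounded_linear R"
    using assms(2) by (simp add: linear_conv_bounded_linear)
  have pow: "R ((T ^^ k) x) = (U ^^ k) (R x)" for k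
    by (induction k) (simp_all add: assms(3))
  show ?thesis
    unfolding op_exp_def
    by (simp add: bounded_linear.suminf[OF R summable_op_exp[OF assms(1)]]
        linear_scale[OF assms(2)] pow)
qed

lemma op_exp_uminus:
  assumes "linear T"
  shows "op_exp (\<lambda>x. - T x) s x = op_exp T (- s) x"
proof -
  have "((\<lambda>x. - T x) ^^ k) x = (- 1) ^ k *\<^sub>R (T ^^ k) x" for k
    by (induction k) (simp_all add: linear_scale[OF assms])
  then show ?thesis
    unfolding op_exp_def
    by (simp add: power_minus[of s] mult.commute)
qed

text \<open>Each coordinate of the exponential is an everywhere convergent real power series in \<open>s\<close>, which
  may be differentiated term by term.\<close>

lemma op_exp_has_vector_derivative:
  assumes "linear T"
  shows "((\<lambda>s. op_exp T s x) has_vector_derivative op_exp T s (T x)) (at s)"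
proof -
  have comp: "(\<lambda>k. (s ^ k / fact k) *\<^sub>R (T ^^ k) y \<bullet> i) sums (op_exp T s y \<bullet> i)" for s y i
    unfolding op_exp_def
    by (intro bounded_linear.sums[OF bounded_linear_inner_left] summable_sums
        summable_op_exp assms)
  have "((\<lambda>s. op_exp T s x \<bullet> i) has_real_derivative op_exp T s (T x) \<bullet> i) (at s)" for i
  proof -
    define a where "a k = (T ^^ k) x \<bullet> i / fact k" for k
    have a: "(\<lambda>k. a k * s ^ k) sums (op_exp T s x \<bullet> i)" for s
      using comp[of s x i] by (simp add: a_def mult.commute)
    have "diffs a k * s ^ k = (s ^ k / fact k) *\<^sub>R (T ^^ k) (T x) \<bullet> i" for k
      by (simp add: a_def diffs_def funpow_swap1 del: of_nat_Suc)
    then have "(\<Sum>k. diffs a k * s ^ k) = op_exp T s (T x) \<bullet> i"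
      using sums_unique[OF comp[of s "T x" i]] by simp
    moreover have "((\<lambda>s. \<Sum>k. a k * s ^ k) has_real_derivative (\<Sum>k. diffs a k * s ^ k)) (at s)"
      using a by (intro termdiffs_strong_converges_everywhere sums_summable)
    moreover have "(\<lambda>s. \<Sum>k. a k * s ^ k) = (\<lambda>s. op_exp T s x \<bullet> i)"
      using sums_unique[OF a] by auto
    ultimately show ?thesis by simp
  qed
  then show ?thesis
    unfolding has_vector_derivative_def
    by (subst has_derivative_componentwise_within)
      (simp add: has_field_derivative_def mult_commute_abs)
qed

section \<open>Solutions of linear differential equations with constant coefficients\<close>

text \<open>Gronwall's argument: if \<open>K\<close> bounds the norm of \<open>T\<close>, then the squared norm of a solution grows
  at rate at most \<open>2 K\<close> times itself, so that it stays zero once it is zero.\<close>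

lemma linear_ode_zero_forward:
  fixes y :: "real \<Rightarrow> 'a::euclidean_space"
  assumes "linear T" and y: "\<And>t. (y has_vector_derivative T (y t)) (at t)"
    and "y 0 = 0" and "t \<ge> 0"
  shows "y t = 0"
proof -
  obtain K where K: "K > 0" "\<And>x. norm (T x) \<le> K * norm x"
    using linear_bounded_pos[OF assms(1)] by blast
  define \<phi> where "\<phi> t = exp (- (2 * K * t)) * (y t \<bullet> y t)" for t
  have deriv: "(\<phi> has_real_derivative
      2 * exp (- (2 * K * t)) * (T (y t) \<bullet> y t - K * (y t \<bullet> y t))) (at t)" for t
  proof -
    have "((\<lambda>t. y t \<bullet> y t) has_real_derivative (2 * (T (y t) \<bullet> y t))) (at t)"
      using has_derivative_inner[OF y[unfolded has_vector_derivative_def, of t]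
          y[unfolded has_vector_derivative_def, of t]]
      by (rule has_derivative_imp_has_field_derivative) (simp add: inner_commute algebra_simps)
    then have "(\<phi> has_real_derivative
        exp (- (2 * K * t)) * (- (2 * K)) * (y t \<bullet> y t)
          + 2 * (T (y t) \<bullet> y t) * exp (- (2 * K * t))) (at t)"
      unfolding \<phi>_def by (intro DERIV_mult) (auto intro!: derivative_eq_intros)
    then show ?thesis
      by (rule DERIV_cong) (simp add: algebra_simps)
  qed
  have "T x \<bullet> x \<le> K * (x \<bullet> x)" for x
  proof -
    have "T x \<bullet> x \<le> norm (T x) * norm x" by (rule norm_cauchy_schwarz)
    also have "\<dots> \<le> K * norm x * norm x" using K by (intro mult_right_mono) auto
    finally show ?thesis by (simp add: dot_square_norm power2_eq_square)
  qed
  then have "2 * exp (- (2 * K * t)) * (T (y t) \<bullet> y t - K * (y t \<bullet> y t)) \<le> 0" for t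
    by (intro mult_nonneg_nonpos) auto
  then have "\<phi> t \<le> \<phi> 0"
    using deriv by (intro DERIV_nonpos_imp_nonincreasing[OF \<open>t \<ge> 0\<close>]) blast
  then have "exp (- (2 * K * t)) * (y t \<bullet> y t) \<le> 0"
    by (simp add: \<phi>_def \<open>y 0 = 0\<close>)
  then have "y t \<bullet> y t \<le> 0"
    by (simp add: mult_le_0_iff)
  then show ?thesis by (metis inner_ge_zero inner_eq_zero_iff antisym)
qed

lemma linear_ode_zero:
  fixes y :: "real \<Rightarrow> 'a::euclidean_space"
  assumes "linear T" and y: "\<And>t. (y has_vector_derivative T (y t)) (at t)" and "y 0 = 0"
  shows "y t = 0"
proof (cases "t \<ge> 0")
  case True
  then show ?thesis using linear_ode_zero_forward assms by blast
next
  case False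
  have "((\<lambda>t. y (- t)) has_vector_derivative - T (y (- t))) (at t)" for t
  proof -
    have "(uminus has_vector_derivative - 1) (at t)"
      by (auto intro!: derivative_eq_intros simp: has_vector_derivative_def)
    from vector_diff_chain_at[OF this y] show ?thesis by (simp add: o_def)
  qed
  then have "y (- (- t)) = 0"
    by (rule linear_ode_zero_forward[OF linear_compose_neg[OF assms(1)]])
      (use False assms(3) in simp_all)
  then show ?thesis by simp
qed

lemma linear_ode_eq_op_exp:
  fixes y :: "real \<Rightarrow> 'a::euclidean_space"
  assumes "linear T" and y: "\<And>t. (y has_vector_derivative T (y t)) (at t)"
  shows "y (t + h) = op_exp T h (y t)"
proof -
  have comm: "op_exp T h (T x) = T (op_exp T h x)" for h x
    using op_exp_intertwine[OF assms(1,1), of T] by simp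
  have "((\<lambda>h. y (t + h)) has_vector_derivative T (y (t + h))) (at h)" for h
  proof -
    have "((+) t has_vector_derivative 1) (at h)"
      by (auto intro!: derivative_eq_intros simp: has_vector_derivative_def)
    from vector_diff_chain_at[OF this y] show ?thesis by (simp add: o_def)
  qed
  then have "((\<lambda>h. y (t + h) - op_exp T h (y t)) has_vector_derivative
      T (y (t + h) - op_exp T h (y t))) (at h)" for h
    unfolding linear_diff[OF assms(1)] comm[symmetric]
    by (intro has_vector_derivative_diff op_exp_has_vector_derivative assms(1))
  then have "y (t + h) - op_exp T h (y t) = 0"
    by (rule linear_ode_zero[OF assms(1)]) (simp add: op_exp_0)
  then show ?thesis by simp
qed

text \<open>Each derivative of \<open>L \<circ> y\<close> is again a linear image of \<open>y\<close>, namely that under \<open>L \<circ> T ^^ k\<close>.\<close>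

lemma smooth_curve_linear_ode:
  fixes y :: "real \<Rightarrow> 'a::euclidean_space" and L :: "'a \<Rightarrow> 'b::euclidean_space"
  assumes "linear T" and y: "\<And>t. (y has_vector_derivative T (y t)) (at t)" and "linear L"
  shows "smooth_curve (\<lambda>t. L (y t))"
proof -
  have deriv: "((\<lambda>t. P (y t)) has_vector_derivative P (T (y t))) (at t)"
    if "linear P" for P :: "'a \<Rightarrow> 'b" and t
    using that y
    by (simp add: linear_conv_bounded_linear bounded_linear.has_vector_derivative)
  have lin: "linear (\<lambda>x. L ((T ^^ k) x))" for k
    using linear_compose[OF linear_funpow[OF assms(1)] assms(3)] by (simp add: o_def)
  have "(curve_deriv ^^ k) (\<lambda>t. L (y t)) = (\<lambda>t. L ((T ^^ k) (y t)))" for k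
  proof (induction k)
    case (Suc k)
    have "curve_deriv (\<lambda>t. L ((T ^^ k) (y t))) = (\<lambda>t. L ((T ^^ k) (T (y t))))"
      using vector_derivative_at[OF deriv[OF lin[of k]]] by (simp add: curve_deriv_def fun_eq_iff)
    then show ?case by (simp add: Suc funpow_swap1)
  qed simp
  then show ?thesis
    unfolding smooth_curve_def
    using deriv[OF lin] by (metis differentiableI_vector)
qed

section \<open>The second difference of a solution\<close>

text \<open>The equation \<open>c'' = B c + d\<close> as a first-order homogeneous linear system for \<open>(c, c', 1)\<close>; the
  constant third coordinate carries the inhomogeneity.\<close>

definition phase_generator ::
  "('a \<Rightarrow> 'a) \<Rightarrow> 'a \<Rightarrow> 'a \<times> 'a \<times> real \<Rightarrow> 'a::euclidean_space \<times> 'a \<times> real"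
  where "phase_generator B d p = (fst (snd p), B (fst p) + snd (snd p) *\<^sub>R d, 0)"

lemma linear_phase_generator:
  assumes "linear B"
  shows "linear (phase_generator B d)"
  by (rule linearI)
    (auto simp: phase_generator_def linear_add[OF assms] linear_scale[OF assms] algebra_simps)

text \<open>Let \<open>P\<close> be the position part of the sum of the flows at times \<open>1\<close> and \<open>- 1\<close>, so that
  \<open>P (c t, c' t, 1) = c (t + 1) + c (t - 1)\<close>. By time reversal the contributions of the initial
  velocity to the two positions are opposite. Hence \<open>P\<close> ignores the velocity, and what remains
  is a linear function of \<open>c t\<close> plus the constant \<open>P (0, 0, 1)\<close>.\<close>

lemma second_difference_affine:
  fixes c c' :: "real \<Rightarrow> 'a::euclidean_space"
  assumes "linear B"
    and ode: "\<And>t. ((\<lambda>t. (c t, c' t, 1)) has_vector_derivative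
      phase_generator B d (c t, c' t, 1)) (at t)"
  obtains M m where "linear M" and "\<And>t. c (t - 1) - 2 *\<^sub>R c t + c (t + 1) = M (c t) + m"
proof
  let ?Z = "phase_generator B d"
  let ?P = "\<lambda>p. fst (op_exp ?Z 1 p + op_exp ?Z (- 1) p)"
  let ?R = "\<lambda>p :: 'a \<times> 'a \<times> real. (fst p, - fst (snd p), snd (snd p))"
  note linZ = linear_phase_generator[OF assms(1), of d]
  note lin = linear_op_exp[OF linZ]
  have linP: "linear ?P"
    by (rule linearI) (simp_all add: linear_add[OF lin] linear_scale[OF lin] scaleR_add_right)
  \<comment> \<open>Reversing the velocity conjugates the generator to its negative.\<close>
  have rev: "op_exp ?Z (- 1) p = ?R (op_exp ?Z 1 (?R p))" for p
  proof -
    have "linear ?R" by (rule linearI) auto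
    moreover have "?R (?Z p) = - ?Z (?R p)" for p
      by (simp add: phase_generator_def)
    ultimately show ?thesis
      using op_exp_intertwine[OF linZ, of ?R "\<lambda>p. - ?Z p" 1 "?R p"] op_exp_uminus[OF linZ]
      by simp
  qed
  have velocity: "?P (0, v, 0) = 0" for v
  proof -
    have "op_exp ?Z 1 (0, - v, 0) = - op_exp ?Z 1 (0, v, 0)"
      using linear_neg[OF lin, of 1 "(0, v, 0)"] by simp
    then show ?thesis by (simp add: rev)
  qed
  show "linear (\<lambda>x. ?P (x, 0, 0) - 2 *\<^sub>R x)"
  proof (rule linearI)
    fix x y :: 'a and r :: real
    show "?P (x + y, 0, 0) - 2 *\<^sub>R (x + y) = ?P (x, 0, 0) - 2 *\<^sub>R x + (?P (y, 0, 0) - 2 *\<^sub>R y)"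
      using linear_add[OF linP, of "(x, 0, 0)" "(y, 0, 0)"] by (simp add: algebra_simps)
    show "?P (r *\<^sub>R x, 0, 0) - 2 *\<^sub>R (r *\<^sub>R x) = r *\<^sub>R (?P (x, 0, 0) - 2 *\<^sub>R x)"
      using linear_scale[OF linP, of r "(x, 0, 0)"] by (simp add: algebra_simps)
  qed
  fix t
  have step: "(c (t + h), c' (t + h), 1) = op_exp ?Z h (c t, c' t, 1)" for h
    using linear_ode_eq_op_exp[OF linZ ode] .
  have "c (t + 1) + c (t - 1) = ?P (c t, c' t, 1)"
    using step[of 1] step[of "- 1"] by (metis fst_add fst_conv add_uminus_conv_diff)
  also have "(c t, c' t, 1::real) = (c t, 0, 0) + ((0, c' t, 0) + (0, 0, 1))"
    by simp
  also have "?P \<dots> = ?P (c t, 0, 0) + ?P (0, 0, 1)"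
    unfolding linear_add[OF linP] velocity by simp
  finally show "c (t - 1) - 2 *\<^sub>R c t + c (t + 1) = (?P (c t, 0, 0) - 2 *\<^sub>R c t) + ?P (0, 0, 1)"
    by (simp add: algebra_simps)
qed

section \<open>Affine invariance\<close>

text \<open>In homogeneous coordinates the evolved curve is \<open>op_exp T s (c t, 1)\<close>, whose derivative in \<open>s\<close>
  is \<open>op_exp T s (T (c t, 1))\<close>. The hypothesis says that \<open>T (c t, 1)\<close> is the second difference of
  the homogeneous curve, and the linear map \<open>op_exp T s\<close> commutes with taking second
  differences in \<open>t\<close>.\<close>

lemma affinely_invariant_if_second_difference_affine:
  fixes c :: "real \<Rightarrow> real ^ 'n"
  assumes "smooth_curve c" and "linear M"
    and diff: "\<And>t. c (t - 1) - 2 *\<^sub>R c t + c (t + 1) = M (c t) + m"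
  shows "affinely_invariant c"
proof -
  define T :: "(real ^ 'n) \<times> real \<Rightarrow> (real ^ 'n) \<times> real"
    where "T p = (M (fst p) + snd p *\<^sub>R m, 0)" for p
  have linT: "linear T"
    by (rule linearI)
      (auto simp: T_def linear_add[OF assms(2)] linear_scale[OF assms(2)] algebra_simps)
  note lin = linear_op_exp[OF linT]
  have linF: "linear (\<lambda>p. fst (op_exp T s p))" for s
    by (rule linearI) (simp_all add: linear_add[OF lin] linear_scale[OF lin])
  define A where "A s = matrix (\<lambda>x. fst (op_exp T s (x, 0)))" for s
  define b where "b s = fst (op_exp T s (0, 1))" for s
  have "linear (\<lambda>x. fst (op_exp T s (x, 0)))" for s
    using linear_compose[OF _ linF, of "\<lambda>x. (x, 0)"] by (simp add: o_def linear_iff)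
  then have A: "A s *v x = fst (op_exp T s (x, 0))" for s x
    unfolding A_def by (metis matrix_vector_mul)
  have C: "A s *v x + b s = fst (op_exp T s (x, 1))" for s x
    using linear_add[OF linF, of s "(x, 0)" "(0, 1)"] by (simp add: A b_def)
  \<comment> \<open>The translations \<open>b s\<close> cancel in the second difference, so only the linear part acts on it.\<close>
  have deriv: "((\<lambda>s. A s *v c t + b s) has_vector_derivative
      ((A s *v c (t - 1) + b s) - 2 *\<^sub>R (A s *v c t + b s) + (A s *v c (t + 1) + b s))) (at s)" for s t
  proof -
    have "((\<lambda>s. fst (op_exp T s (c t, 1))) has_vector_derivative
        fst (op_exp T s (T (c t, 1)))) (at s)"
      by (intro bounded_linear.has_vector_derivative[OF bounded_linear_fst]
          op_exp_has_vector_derivative linT)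
    moreover have "fst (op_exp T s (T (c t, 1))) = A s *v (c (t - 1) - 2 *\<^sub>R c t + c (t + 1))"
      by (simp add: A T_def diff)
    moreover have "\<dots> = (A s *v c (t - 1) + b s) - 2 *\<^sub>R (A s *v c t + b s) + (A s *v c (t + 1) + b s)"
      unfolding matrix_vector_right_distrib matrix_vector_mult_diff_distrib
        matrix_vector_mult_scaleR
      by (simp add: scaleR_2)
    ultimately show ?thesis by (simp add: C)
  qed
  have "continuous_on {0..<1} (\<lambda>s. A s *v c t + b s)" for t
    using deriv by (intro continuous_at_imp_continuous_on ballI)
      (blast intro: has_vector_derivative_continuous)
  moreover have "A 0 *v c t + b 0 = c t" for t
    by (simp add: C op_exp_0)
  ultimately show ?thesis
    unfolding affinely_invariant_def Let_def
    using assms(1) deriv zero_less_one by blast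
qed

theorem proposition6:
  fixes B :: "real ^ 'n ^ 'n" and d :: "real ^ 'n" and c :: "real \<Rightarrow> real ^ 'n"
  assumes "\<And>t. c differentiable (at t)"
    and "\<And>t. (curve_deriv c has_vector_derivative (B *v c t + d)) (at t)"
    and "inj_on (\<lambda>k. (curve_deriv ^^ k) c 0) {1..CARD('n)}"
    and "independent ((\<lambda>k. (curve_deriv ^^ k) c 0) ` {1..CARD('n)})"
  shows "affinely_invariant c"
proof -
  let ?Z = "phase_generator ((*v) B) d"
  have linB: "linear ((*v) B)" by simp
  have "(c has_vector_derivative curve_deriv c t) (at t)" for t
    unfolding curve_deriv_def using assms(1) by (simp add: vector_derivative_works)
  then have ode: "((\<lambda>t. (c t, curve_deriv c t, 1)) has_vector_derivative
      ?Z (c t, curve_deriv c t, 1)) (at t)" for t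
    unfolding phase_generator_def
    using assms(2) by (auto intro!: has_vector_derivative_Pair has_vector_derivative_const)
  have "smooth_curve (\<lambda>t. fst (c t, curve_deriv c t, 1 :: real))"
    by (rule smooth_curve_linear_ode[OF linear_phase_generator[OF linB] ode])
      (simp add: linear_fst)
  then have smooth: "smooth_curve c" by simp
  obtain M m where "linear M" "\<And>t. c (t - 1) - 2 *\<^sub>R c t + c (t + 1) = M (c t) + m"
    using second_difference_affine[OF linB ode] by blast
  with smooth show ?thesis
    by (rule affinely_invariant_if_second_difference_affine)
qed

end
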